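(* There are infinitely many positive integers $n$ for which there exists a non-bipartite projective quadrangulation on $n$ vertices containing no odd cycle transversal of size less than $\sqrt{n}$.
   Context: A projective quadrangulation is a graph embedded in the real projective plane $\mathbb{P}^2$ so that every face is bounded by four edges. A non-bipartite projective quadrangulation is such a graph that is not bipartite. An odd cycle transversal of a graph $G$ is a set $S$ of vertices such that $G-S$ is bipartite. *)

theory Defs
  imports "HOL-Analysis.Analysis"
begin

section \<open>The real projective plane\<close>

text \<open>Points are the lines through the origin of \<open>\<real>\<^sup>3\<close>, with the quotient topology
  induced by \<open>x \<mapsto> span {x}\<close> on the non-zero vectors.\<close>

definition projective_plane :: "(real ^ 3) set topology" where
  "projective_plane = topology (\<lambda>U. U \<subseteq> (\<lambda>x. span {x}) ` (- {0}) \<and> open {x. x \<noteq> 0 \<and> span {x} \<in> U})"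

lemma openin_projective_plane:
  "openin projective_plane U \<longleftrightarrow>
     U \<subseteq> (\<lambda>x. span {x}) ` (- {0}) \<and> open {x. x \<noteq> 0 \<and> span {x} \<in> U}"
proof -
  let ?L = "\<lambda>U. U \<subseteq> (\<lambda>x::real^3. span {x}) ` (- {0}) \<and> open {x. x \<noteq> 0 \<and> span {x} \<in> U}"
  have "istopology ?L"
    unfolding istopology_def
  proof (intro conjI allI impI)
    fix S T assume S: "?L S" and T: "?L T"
    show "S \<inter> T \<subseteq> (\<lambda>x. span {x}) ` (- {0})" using S by blast
    have "{x. x \<noteq> 0 \<and> span {x} \<in> S \<inter> T} = {x. x \<noteq> 0 \<and> span {x} \<in> S} \<inter> {x. x \<noteq> 0 \<and> span {x} \<in> T}"
      by blast
    then show "open {x. x \<noteq> 0 \<and> span {x} \<in> S \<inter> T}"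
      using open_Int [OF conjunct2 [OF S] conjunct2 [OF T]] by (simp only:)
  next
    fix K assume K: "\<forall>S\<in>K. ?L S"
    show "\<Union> K \<subseteq> (\<lambda>x. span {x}) ` (- {0})" using K by blast
    have "{x. x \<noteq> 0 \<and> span {x} \<in> \<Union> K} = (\<Union>S\<in>K. {x. x \<noteq> 0 \<and> span {x} \<in> S})"
      by blast
    then show "open {x. x \<noteq> 0 \<and> span {x} \<in> \<Union> K}"
      using K by (metis (no_types, lifting) open_UN)
  qed
  then show ?thesis
    by (simp only: projective_plane_def topology_inverse')
qed

lemma topspace_projective_plane [simp]:
  "topspace projective_plane = (\<lambda>x. span {x}) ` (- {0})"
proof -
  have "{x::real^3. x \<noteq> 0 \<and> span {x} \<in> (\<lambda>x. span {x}) ` (- {0})} = - {0}" by blast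
  then have "openin projective_plane ((\<lambda>x. span {x}) ` (- {0}))"
    by (simp add: openin_projective_plane open_Compl)
  then show ?thesis
    using openin_projective_plane [of "topspace projective_plane"] openin_subset [of projective_plane]
    by (intro subset_antisym) simp_all
qed

lemma quotient_map_projective_plane:
  "quotient_map (top_of_set (- {0})) projective_plane (\<lambda>x. span {x})"
proof -
  have "openin (top_of_set (- {0})) {x \<in> - {0}. span {x} \<in> U} \<longleftrightarrow> open {x. x \<noteq> 0 \<and> span {x} \<in> U}"
    for U :: "(real ^ 3) set set"
  proof -
    have "open (- {0 :: real ^ 3})" by (simp add: open_Compl)
    moreover have "{x \<in> - {0}. span {x} \<in> U} = {x. x \<noteq> 0 \<and> span {x} \<in> U}" by simp
    ultimately show ?thesis
      by (auto simp: openin_open_eq)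
  qed
  then show ?thesis
    unfolding quotient_map_def
    by (auto simp only: openin_projective_plane topspace_projective_plane topspace_euclidean_subtopology)
qed


section \<open>Graphs\<close>

definition simple_graph :: "'v set \<Rightarrow> 'v set set \<Rightarrow> bool" where
  "simple_graph V E \<longleftrightarrow> finite V \<and> (\<forall>e\<in>E. e \<subseteq> V \<and> card e = 2)"

definition bipartite :: "'v set \<Rightarrow> 'v set set \<Rightarrow> bool" where
  "bipartite V E \<longleftrightarrow>
     (\<exists>A B. A \<union> B = V \<and> A \<inter> B = {} \<and> (\<forall>e\<in>E. \<exists>a\<in>A. \<exists>b\<in>B. e = {a, b}))"

definition odd_cycle_transversal :: "'v set \<Rightarrow> 'v set set \<Rightarrow> 'v set \<Rightarrow> bool" where
  "odd_cycle_transversal V E S \<longleftrightarrow> S \<subseteq> V \<and> bipartite (V - S) {e \<in> E. e \<inter> S = {}}"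


section \<open>Embedded graphs and quadrangulations\<close>

text \<open>\<open>p\<close> places the vertices and \<open>\<gamma>\<close> draws the edges as arcs that meet only at common end vertices.\<close>

definition graph_embedding ::
  "'a topology \<Rightarrow> 'v set \<Rightarrow> 'v set set \<Rightarrow> ('v \<Rightarrow> 'a) \<Rightarrow> ('v set \<Rightarrow> real \<Rightarrow> 'a) \<Rightarrow> bool" where
  "graph_embedding X V E p \<gamma> \<longleftrightarrow>
     inj_on p V \<and> p ` V \<subseteq> topspace X \<and>
     (\<forall>e\<in>E. embedding_map (top_of_set {0..1}) X (\<gamma> e) \<and>
            {\<gamma> e 0, \<gamma> e 1} = p ` e \<and>
            \<gamma> e ` {0<..<1} \<inter> p ` V = {}) \<and>
     (\<forall>e\<in>E. \<forall>f\<in>E. e \<noteq> f \<longrightarrow> \<gamma> e ` {0<..<1} \<inter> \<gamma> f ` {0<..<1} = {})"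

definition drawing ::
  "'v set \<Rightarrow> 'v set set \<Rightarrow> ('v \<Rightarrow> 'a) \<Rightarrow> ('v set \<Rightarrow> real \<Rightarrow> 'a) \<Rightarrow> 'a set" where
  "drawing V E p \<gamma> = p ` V \<union> (\<Union>e\<in>E. \<gamma> e ` {0..1})"

definition faces ::
  "'a topology \<Rightarrow> 'v set \<Rightarrow> 'v set set \<Rightarrow> ('v \<Rightarrow> 'a) \<Rightarrow> ('v set \<Rightarrow> real \<Rightarrow> 'a) \<Rightarrow> 'a set set" where
  "faces X V E p \<gamma> =
     connected_components_of (subtopology X (topspace X - drawing V E p \<gamma>))"

definition square_sides :: "(real \<times> real) set set" where
  "square_sides = {{0..1} \<times> {0}, {1} \<times> {0..1}, {0..1} \<times> {1}, {0} \<times> {0..1}}"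

text \<open>\<open>F\<close> is an open disc whose boundary is traversed by a closed walk of four edges: it is the
  homeomorphic image of the interior of a square whose closed sides are each carried
  homeomorphically onto an edge. Corners then necessarily go to vertices, so the sides in cyclic
  order trace out the walk. Nothing forces the four edges to be distinct in general.\<close>

definition bounded_by_four_edges ::
  "'a topology \<Rightarrow> 'v set set \<Rightarrow> ('v set \<Rightarrow> real \<Rightarrow> 'a) \<Rightarrow> 'a set \<Rightarrow> bool" where
  "bounded_by_four_edges X E \<gamma> F \<longleftrightarrow>
     (\<exists>\<phi> :: real \<times> real \<Rightarrow> 'a.
        continuous_map (top_of_set ({0..1} \<times> {0..1})) X \<phi> \<and>
        embedding_map (top_of_set ({0<..<1} \<times> {0<..<1})) X \<phi> \<and>
        \<phi> ` ({0<..<1} \<times> {0<..<1}) = F \<and>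
        (\<forall>s\<in>square_sides. embedding_map (top_of_set s) X \<phi> \<and> (\<exists>e\<in>E. \<phi> ` s = \<gamma> e ` {0..1})))"

definition projective_quadrangulation :: "'v set \<Rightarrow> 'v set set \<Rightarrow> bool" where
  "projective_quadrangulation V E \<longleftrightarrow>
     simple_graph V E \<and>
     (\<exists>p \<gamma>. graph_embedding projective_plane V E p \<gamma> \<and>
        (\<forall>F\<in>faces projective_plane V E p \<gamma>. bounded_by_four_edges projective_plane E \<gamma> F))"

end

theory Submission
  imports Defs "HOL-Library.Nat_Bijection"
begin

text \<open>
  Take the \<open>(a + 1) \<times> (a + 1)\<close> grid and join each pair of antipodal boundary vertices
  \<open>(i, j)\<close> and \<open>(a - i, a - j)\<close>. This is the natural square tiling of the surface of an
  \<open>a \<times> a \<times> 1\<close> box modulo its central symmetry: the grid is the top (identified with the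
  bottom), and the antipodal edges are the vertical unit edges on the sides. Projecting the box
  surface from its centre gives the embedding in the projective plane.

  It has \<open>(a + 1)\<^sup>2\<close> vertices, so it suffices that every odd cycle transversal \<open>S\<close> has at least
  \<open>a + 1\<close> elements. Otherwise some column avoids \<open>S\<close>. Compare a proper 2-colouring of the rest
  with the chessboard colouring: agreement is constant along grid paths avoiding \<open>S\<close> and changes
  across antipodal edges. If row \<open>i\<close> avoids \<open>S\<close>, then row \<open>a - i\<close> agrees with it on the free
  column but differs at both ends, so it meets \<open>S\<close> on both sides of that column. Hence rows \<open>i\<close>
  and \<open>a - i\<close> always contain two elements of \<open>S\<close> between them, counted with multiplicity when
  \<open>i = a - i\<close>, and summing over all rows gives \<open>2 * card S \<ge> 2 * (a + 1)\<close>.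
\<close>

section \<open>Transversals of the antipodal grid\<close>

lemma row_sum_symmetric:
  fixes f :: "nat \<Rightarrow> nat"
  assumes "\<And>i. i \<le> a \<Longrightarrow> 2 \<le> f i + f (a - i)"
  shows "a + 1 \<le> (\<Sum>i\<le>a. f i)"
proof -
  have "(\<Sum>i\<le>a. f (a - i)) = (\<Sum>i\<le>a. f i)"
    by (rule sum.reindex_bij_witness [of _ "\<lambda>i. a - i" "\<lambda>i. a - i"]) auto
  then have "2 * (\<Sum>i\<le>a. f i) = (\<Sum>i\<le>a. f i + f (a - i))"
    by (simp add: sum.distrib)
  also have "\<dots> \<ge> (\<Sum>i\<le>a. 2)"
    using assms by (intro sum_mono) auto
  finally show ?thesis by simp
qed

lemma constant_on_interval:
  fixes f :: "nat \<Rightarrow> 'b"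
  assumes "p \<le> q" and "\<And>m. p \<le> m \<Longrightarrow> m < q \<Longrightarrow> f m = f (Suc m)"
  shows "f p = f q"
  using assms by (induction q rule: dec_induct) auto

lemma card_transversal_antipodal_grid:
  fixes a :: nat and S :: "(nat \<times> nat) set" and c :: "nat \<times> nat \<Rightarrow> bool"
  assumes S: "S \<subseteq> {..a} \<times> {..a}"
    and right: "\<And>i j. \<lbrakk>i < a; j \<le> a; (i, j) \<notin> S; (Suc i, j) \<notin> S\<rbrakk> \<Longrightarrow> c (i, j) \<noteq> c (Suc i, j)"
    and up: "\<And>i j. \<lbrakk>i \<le> a; j < a; (i, j) \<notin> S; (i, Suc j) \<notin> S\<rbrakk> \<Longrightarrow> c (i, j) \<noteq> c (i, Suc j)"
    and antipodal: "\<And>i. \<lbrakk>i \<le> a; (i, a) \<notin> S; (a - i, 0) \<notin> S\<rbrakk> \<Longrightarrow> c (i, a) \<noteq> c (a - i, 0)"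
  shows "a + 1 \<le> card S"
proof (rule ccontr)
  assume small: "\<not> a + 1 \<le> card S"
  have fin: "finite S" using S by (rule finite_subset) simp
  \<comment> \<open>With at most \<open>a\<close> elements, \<open>S\<close> cannot project onto all
    \<open>a + 1\<close> second coordinates; a missed value \<open>j\<close> gives the free
    column.\<close>
  have "\<not> {..a} \<subseteq> snd ` S"
    using small fin card_image_le [OF fin, of snd] card_mono [of "snd ` S" "{..a}"] by fastforce
  then obtain j where j: "j \<le> a" "\<And>i. (i, j) \<notin> S" by force
  define d where "d i m = (c (i, m) = even (i + m))" for i m
  define R where "R i = {m. (i, m) \<in> S}" for i
  have finR: "finite (R i)" for i
    using fin unfolding R_def by (rule finite_imageI [where h = snd, THEN rev_finite_subset]) force
  have column: "d i j = d 0 j" if "i \<le> a" for i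
    by (rule constant_on_interval [of 0 i "\<lambda>i. d i j", symmetric]) (use right j that in \<open>auto simp: d_def\<close>)
  have row: "d i p = d i q" if "i \<le> a" "p \<le> q" "q \<le> a" "R i \<inter> {p..q} = {}" for i p q
  proof (rule constant_on_interval [OF that(2)])
    fix m assume m: "p \<le> m" "m < q"
    then have "m \<notin> R i" "Suc m \<notin> R i" using that(4) by (auto simp: disjoint_iff)
    then show "d i m = d i (Suc m)" using up [of i m] that m by (auto simp: d_def R_def)
  qed
  \<comment> \<open>The numbers \<open>i + a\<close> and \<open>(a - i) + 0\<close> have the same
    parity, so the chessboard colouring agrees at the two ends of this antipodal edge while
    \<open>c\<close> differs.\<close>
  have flip: "d i a \<noteq> d (a - i) 0" if "i \<le> a" "a \<notin> R i" "0 \<notin> R (a - i)" for i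
    using antipodal [of i] that by (auto simp: d_def R_def)
  \<comment> \<open>When \<open>i = a - i\<close> the conclusion contradicts
    \<open>R i = {}\<close>, so this also excludes a free middle row.\<close>
  have two: "2 \<le> card (R (a - i))" if i: "i \<le> a" and free: "R i = {}" for i
  proof -
    have ends: "d i 0 = d 0 j" "d i a = d 0 j"
      using row [of i 0 j] row [of i j a] column [of i] i j free by auto
    have mid: "d (a - i) j = d 0 j" using column [of "a - i"] by simp
    have "R (a - i) \<inter> {0..j} \<noteq> {}"
      using row [of "a - i" 0 j] flip [of i] i j free mid ends by (auto simp: disjoint_iff)
    moreover have "R (a - i) \<inter> {j..a} \<noteq> {}"
      using row [of "a - i" j a] flip [of "a - i"] i j free mid ends by (auto simp: disjoint_iff)
    ultimately obtain p q where "p \<in> R (a - i)" "p \<le> j" "q \<in> R (a - i)" "j \<le> q" by auto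
    \<comment> \<open>Both intervals contain \<open>j\<close>, but column \<open>j\<close> avoids
      \<open>S\<close>, so the two elements found lie strictly on opposite sides of it.\<close>
    moreover have "j \<notin> R (a - i)" using j by (simp add: R_def)
    ultimately have "p \<noteq> q" "{p, q} \<subseteq> R (a - i)" by auto
    then show ?thesis using card_mono [OF finR [of "a - i"], of "{p, q}"] by simp
  qed
  have "2 \<le> card (R i) + card (R (a - i))" if i: "i \<le> a" for i
  proof (cases "R i = {} \<or> R (a - i) = {}")
    case True
    then show ?thesis using two [of i] two [of "a - i"] i by auto
  next
    case False
    then have "0 < card (R i)" "0 < card (R (a - i))" using finR by (simp_all add: card_gt_0_iff)
    then show ?thesis by linarith
  qed
  then have "a + 1 \<le> (\<Sum>i\<le>a. card (R i))" by (rule row_sum_symmetric)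
  also have "\<dots> = card (SIGMA i:{..a}. R i)" using finR by simp
  also have "(SIGMA i:{..a}. R i) = S" using S by (auto simp: R_def)
  finally show False using small by simp
qed

section \<open>Topology of the projective plane\<close>

lemma continuous_map_projective_plane_iff:
  "continuous_map projective_plane X g \<longleftrightarrow> continuous_map (top_of_set (- {0})) X (\<lambda>x. g (span {x}))"
  using continuous_compose_quotient_map_eq [OF quotient_map_projective_plane, of X g] by (simp add: o_def)

lemma continuous_map_into_projective_plane:
  fixes f :: "'a::topological_space \<Rightarrow> real ^ 3"
  assumes "continuous_on T f" "\<And>x. x \<in> T \<Longrightarrow> f x \<noteq> 0"
  shows "continuous_map (top_of_set T) projective_plane (\<lambda>x. span {f x})"
proof -
  have "continuous_map (top_of_set T) (top_of_set (- {0})) f"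
    using assms by (auto simp: continuous_map_in_subtopology)
  then show ?thesis
    by (rule continuous_map_compose [OF _ quotient_imp_continuous_map [OF quotient_map_projective_plane],
          unfolded o_def])
qed

lemma span_singleton_eq_iff:
  fixes x y :: "'a::real_vector"
  assumes "x \<noteq> 0"
  shows "span {x} = span {y} \<longleftrightarrow> (\<exists>c. c \<noteq> 0 \<and> y = c *\<^sub>R x)"
proof
  assume eq: "span {x} = span {y}"
  have "x \<in> span {y}" "y \<in> span {x}"
    using eq span_base [of x "{x}"] span_base [of y "{y}"] by auto
  then obtain c where "y = c *\<^sub>R x" by (auto simp: span_singleton)
  moreover have "c \<noteq> 0" using \<open>x \<in> span {y}\<close> assms calculation by auto
  ultimately show "\<exists>c. c \<noteq> 0 \<and> y = c *\<^sub>R x" by blast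
next
  assume "\<exists>c. c \<noteq> 0 \<and> y = c *\<^sub>R x"
  then obtain c where c: "c \<noteq> 0" "y = c *\<^sub>R x" by blast
  then have "x = (1 / c) *\<^sub>R y" by simp
  then show "span {x} = span {y}"
    unfolding span_eq using c(2) span_scale [of y "{y}" "1 / c"] span_scale [of x "{x}" c]
    by (simp add: span_base)
qed

text \<open>The functions \<open>span {y} \<mapsto> (x \<bullet> y)\<^sup>2 / \<parallel>y\<parallel>\<^sup>2\<close> separate points, by the equality case of
  the Cauchy--Schwarz inequality.\<close>

lemma Hausdorff_projective_plane: "Hausdorff_space projective_plane"
  unfolding Hausdorff_space_def
proof clarify
  fix A B :: "(real ^ 3) set"
  assume AB: "A \<in> topspace projective_plane" "B \<in> topspace projective_plane" "A \<noteq> B"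
  then obtain x y where x: "x \<noteq> 0" "A = span {x}" and y: "y \<noteq> 0" "B = span {y}" by auto
  define f where "f z = (x \<bullet> z)\<^sup>2 / (z \<bullet> z)" for z
  \<comment> \<open>\<open>f\<close> is invariant under non-zero scaling, so it descends to lines
    and the choice of a spanning vector is immaterial.\<close>
  define g where "g C = f (SOME z. z \<noteq> 0 \<and> C = span {z})" for C
  have f_scale: "f (c *\<^sub>R z) = f z" if "c \<noteq> 0" for c z
    using that by (simp add: f_def power2_eq_square)
  have g: "g (span {z}) = f z" if nz: "z \<noteq> 0" for z
    unfolding g_def
  proof (rule someI2)
    show "z \<noteq> 0 \<and> span {z} = span {z}" using nz by simp
  next
    fix w assume "w \<noteq> 0 \<and> span {z} = span {w}"
    then obtain c where "c \<noteq> 0" "w = c *\<^sub>R z" using span_singleton_eq_iff [OF nz, of w] by auto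
    then show "f w = f z" using f_scale by simp
  qed
  have "continuous_on (- {0}) f"
    unfolding f_def by (intro continuous_intros) auto
  then have "continuous_on (- {0}) (\<lambda>z. g (span {z}))"
    by (rule continuous_on_eq) (simp add: g)
  then have g_cont: "continuous_map projective_plane euclidean g"
    by (simp add: continuous_map_projective_plane_iff)
  have "f x \<noteq> f y"
  proof
    assume "f x = f y"
    then have "(x \<bullet> y)\<^sup>2 = (x \<bullet> x) * (y \<bullet> y)" using x y by (simp add: f_def field_simps power2_eq_square)
    then have "\<bar>x \<bullet> y\<bar>\<^sup>2 = (norm x * norm y)\<^sup>2" by (simp add: power_mult_distrib power2_norm_eq_inner)
    then have "\<bar>x \<bullet> y\<bar> = norm x * norm y" by (rule power2_eq_imp_eq) simp_all
    then obtain s where "s \<noteq> 0" and s: "norm x *\<^sub>R y = s *\<^sub>R x"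
      using y(1) that [of "norm y"] that [of "- norm y"] by (auto simp: norm_cauchy_schwarz_abs_eq)
    then have "y = (s / norm x) *\<^sub>R x"
      using arg_cong [OF s, of "scaleR (1 / norm x)"] x(1) unfolding scaleR_scaleR by simp
    then have "span {x} = span {y}"
      unfolding span_singleton_eq_iff [OF x(1)] using x(1) \<open>s \<noteq> 0\<close> by (intro exI [of _ "s / norm x"]) simp
    then show False using AB x y by simp
  qed
  then obtain U V where UV: "open U" "open V" "f x \<in> U" "f y \<in> V" "U \<inter> V = {}"
    by (metis hausdorff)
  have "openin projective_plane {C \<in> topspace projective_plane. g C \<in> W}" if "open W" for W
    using openin_continuous_map_preimage [OF g_cont, of W] that by simp
  moreover have "g A = f x" "g B = f y" using g x y by simp_all
  moreover have "disjnt {C \<in> topspace projective_plane. g C \<in> U} {C \<in> topspace projective_plane. g C \<in> V}"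
    using UV(5) by (auto simp only: disjnt_iff)
  ultimately show "\<exists>U V. openin projective_plane U \<and> openin projective_plane V \<and> A \<in> U \<and> B \<in> V \<and> disjnt U V"
    using UV(1-4) AB(1,2) by (metis (no_types, lifting) mem_Collect_eq)
qed

text \<open>A continuous injection of a compact space into a Hausdorff space is an embedding, and
  embeddings restrict to subspaces. The separate set \<open>T\<close> allows non-compact domains
  such as the open square.\<close>

lemma embedding_map_compact_projective_plane:
  fixes f :: "'a::topological_space \<Rightarrow> real ^ 3"
  assumes "compact K" "continuous_on K f" "\<And>x. x \<in> K \<Longrightarrow> f x \<noteq> 0" "inj_on (\<lambda>x. span {f x}) K" "T \<subseteq> K"
  shows "embedding_map (top_of_set T) projective_plane (\<lambda>x. span {f x})"
proof -
  have "embedding_map (top_of_set K) projective_plane (\<lambda>x. span {f x})"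
    using assms
    by (intro continuous_imp_embedding_map continuous_map_into_projective_plane Hausdorff_projective_plane)
       (auto simp: compact_space_subtopology)
  moreover have "embedding_map (top_of_set T) (top_of_set K) id"
    using assms(5) by (simp add: embedding_map_def subtopology_subtopology Int_absorb1)
  ultimately show ?thesis
    using embedding_map_compose [of "top_of_set T" "top_of_set K" id] by (metis comp_id)
qed

text \<open>The complement of each part is a finite union of closed sets, so a connected set meeting
  one part cannot meet another; maximality of components gives the reverse inclusion. Faces can thus
  be identified from compactness of the closed squares, without first showing that the open squares
  are open in the plane.\<close>

lemma connected_components_of_finite_closed_partition:
  assumes "finite \<Q>" "pairwise disjnt \<Q>" "topspace X \<subseteq> \<Union>\<Q>"
    and "\<And>Q. Q \<in> \<Q> \<Longrightarrow> closedin X Q" "\<And>Q. Q \<in> \<Q> \<Longrightarrow> connectedin X Q"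
  shows "connected_components_of X \<subseteq> \<Q>"
proof
  fix C assume C: "C \<in> connected_components_of X"
  then have conn: "connectedin X C" and "C \<noteq> {}" "C \<subseteq> topspace X"
    by (simp_all add: connectedin_connected_components_of nonempty_connected_components_of
        connected_components_of_subset)
  then obtain Q where Q: "Q \<in> \<Q>" "C \<inter> Q \<noteq> {}" using assms(3) by blast
  have "closedin X (\<Union>(\<Q> - {Q}))"
    using assms(1,4) by (intro closedin_Union) auto
  moreover have "Q \<inter> \<Union>(\<Q> - {Q}) = {}"
    using assms(2) Q(1) by (force simp: pairwise_def disjnt_def)
  moreover have "C \<subseteq> Q \<union> \<Union>(\<Q> - {Q})" using \<open>C \<subseteq> topspace X\<close> assms(3) by blast
  ultimately have "\<Union>(\<Q> - {Q}) \<inter> C = {}"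
    using conn assms(4) [OF Q(1)] Q(2) unfolding connectedin_closedin by blast
  then have "C \<subseteq> Q" using \<open>C \<subseteq> Q \<union> _\<close> by blast
  moreover have "Q \<subseteq> C"
    using connected_components_of_maximal [OF C assms(5) [OF Q(1)]] Q(2) by (simp add: disjnt_def)
  ultimately show "C \<in> \<Q>" using Q(1) by simp
qed

section \<open>The surface of the box\<close>

text \<open>\<open>box_vector a\<close> moves the box \<open>[0, a]\<^sup>2 \<times> [0, 1]\<close> to \<open>[-a, a]\<^sup>2 \<times> [-1, 1]\<close>, which is symmetric
  about the origin, so that \<open>antipode\<close> becomes negation.\<close>

definition box_vector :: "nat \<Rightarrow> real \<times> real \<times> real \<Rightarrow> real ^ 3" where
  "box_vector a = (\<lambda>(x, y, z). (2 * x - a) *\<^sub>R axis 1 1 + (2 * y - a) *\<^sub>R axis 2 1 + (2 * z - 1) *\<^sub>R axis 3 1)"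

lemma box_vector_nth [simp]:
  "box_vector a (x, y, z) $ 1 = 2 * x - a"
  "box_vector a (x, y, z) $ 2 = 2 * y - a"
  "box_vector a (x, y, z) $ 3 = 2 * z - 1"
  by (simp_all add: box_vector_def axis_def)

definition line :: "nat \<Rightarrow> real \<times> real \<times> real \<Rightarrow> (real ^ 3) set" where
  "line a u = span {box_vector a u}"

definition box_surface :: "nat \<Rightarrow> (real \<times> real \<times> real) set" where
  "box_surface a = {(x, y, z). 0 \<le> x \<and> x \<le> a \<and> 0 \<le> y \<and> y \<le> a \<and> 0 \<le> z \<and> z \<le> 1 \<and>
     (x \<in> {0, real a} \<or> y \<in> {0, real a} \<or> z \<in> {0, 1})}"

definition antipode :: "nat \<Rightarrow> real \<times> real \<times> real \<Rightarrow> real \<times> real \<times> real" where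
  "antipode a = (\<lambda>(x, y, z). (a - x, a - y, 1 - z))"

text \<open>For \<open>a > 0\<close> this is the norm whose sphere of radius \<open>a\<close> is the
  boundary of the centred box, so every line through the origin meets that boundary in one antipodal
  pair.\<close>

definition box_norm :: "nat \<Rightarrow> real ^ 3 \<Rightarrow> real" where
  "box_norm a v = max \<bar>v $ 1\<bar> (max \<bar>v $ 2\<bar> (a * \<bar>v $ 3\<bar>))"

lemma box_norm_scale: "box_norm a (c *\<^sub>R v) = \<bar>c\<bar> * box_norm a v"
  by (simp add: box_norm_def abs_mult max_mult_distrib_left mult.left_commute)

lemma box_norm_pos: "0 < a \<Longrightarrow> v \<noteq> 0 \<Longrightarrow> 0 < box_norm a v"
  by (auto simp: box_norm_def vec_eq_iff forall_3 less_max_iff_disj)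

lemma box_norm_surface:
  assumes "0 < a" "u \<in> box_surface a"
  shows "box_norm a (box_vector a u) = a"
proof -
  obtain x y z where u: "u = (x, y, z)" by (metis prod_cases3)
  have "\<bar>2 * x - a\<bar> \<le> a" "\<bar>2 * y - a\<bar> \<le> a" "\<bar>2 * z - 1\<bar> \<le> 1"
    using assms(2) by (auto simp: box_surface_def u abs_le_iff)
  moreover have "\<bar>2 * x - a\<bar> = a \<or> \<bar>2 * y - a\<bar> = a \<or> \<bar>2 * z - 1\<bar> = 1"
    using assms(2) by (auto simp: box_surface_def u)
  moreover have "a * \<bar>2 * z - 1\<bar> \<le> a"
    using calculation(3) mult_left_le [of "\<bar>2 * z - 1\<bar>" "real a"] by simp
  ultimately show ?thesis by (auto simp: u box_norm_def max_def)
qed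

lemma box_vector_nonzero: "0 < a \<Longrightarrow> u \<in> box_surface a \<Longrightarrow> box_vector a u \<noteq> 0"
  using box_norm_surface [of a u] by (auto simp: box_norm_def)

lemma box_vector_inject: "box_vector a u = box_vector a v \<longleftrightarrow> u = v"
  by (cases u; cases v) (auto simp: vec_eq_iff forall_3)

lemma box_vector_antipode: "box_vector a (antipode a u) = - box_vector a u"
  by (cases u) (auto simp: vec_eq_iff forall_3 antipode_def)

lemma line_antipode: "line a (antipode a u) = line a u"
proof (cases "box_vector a u = 0")
  case False
  have "box_vector a (antipode a u) = (-1) *\<^sub>R box_vector a u" by (simp add: box_vector_antipode)
  then show ?thesis
    unfolding line_def using span_singleton_eq_iff [OF False] by (metis neg_equal_0_iff_equal zero_neq_one)
qed (simp add: line_def box_vector_antipode)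

text \<open>Two spanning vectors of one line differ by a scalar. Both have \<open>box_norm\<close>
  equal to \<open>a\<close>, so the scalar is 1 or -1.\<close>

lemma line_eq_iff:
  assumes "0 < a" "u \<in> box_surface a" "v \<in> box_surface a"
  shows "line a u = line a v \<longleftrightarrow> v = u \<or> v = antipode a u"
proof
  assume "line a u = line a v"
  then obtain c where c: "box_vector a v = c *\<^sub>R box_vector a u"
    unfolding line_def using span_singleton_eq_iff [OF box_vector_nonzero [OF assms(1,2)]] by blast
  have "\<bar>c\<bar> * a = a"
    using box_norm_scale [of a c "box_vector a u"] box_norm_surface [OF assms(1)] assms(2,3)
    by (simp flip: c)
  then have "c = 1 \<or> c = -1" using assms(1) by auto
  then have "box_vector a v = box_vector a u \<or> box_vector a v = box_vector a (antipode a u)"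
    using c by (auto simp: box_vector_antipode)
  then show "v = u \<or> v = antipode a u" by (simp add: box_vector_inject)
qed (auto simp: line_antipode)

lemma line_in_projective_plane: "0 < a \<Longrightarrow> u \<in> box_surface a \<Longrightarrow> line a u \<in> topspace projective_plane"
  using box_vector_nonzero by (auto simp: line_def)

text \<open>Scaling by \<open>box_norm\<close> moves a spanning vector to the box surface. Choosing
  the sign that makes an extremal coordinate positive then leaves only three of the six faces, one
  from each opposite pair.\<close>

lemma projective_plane_point_cases:
  assumes "0 < a" "A \<in> topspace projective_plane"
  obtains x y z :: real where "0 \<le> x" "x \<le> a" "0 \<le> y" "y \<le> a" "0 \<le> z" "z \<le> 1"
    "x = a \<or> y = a \<or> z = 1" "A = line a (x, y, z)"
proof -
  obtain v where v: "v \<noteq> 0" "A = span {v}" using assms(2) by auto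
  define w where "w = (a / box_norm a v) *\<^sub>R v"
  have pos: "0 < box_norm a v" using box_norm_pos assms(1) v(1) by blast
  have w: "box_norm a w = a" using pos by (simp add: w_def box_norm_scale)
  have Aw: "A = span {s *\<^sub>R w}" if "s \<noteq> 0" for s
    using v that pos assms(1) unfolding v(2) span_singleton_eq_iff [OF v(1)]
    by (intro exI [of _ "s * (a / box_norm a v)"]) (simp add: w_def)
  have "\<bar>w $ 1\<bar> = a \<or> \<bar>w $ 2\<bar> = a \<or> a * \<bar>w $ 3\<bar> = a"
    using w unfolding box_norm_def max_def by (auto split: if_splits)
  then have "\<bar>w $ 1\<bar> = a \<or> \<bar>w $ 2\<bar> = a \<or> \<bar>w $ 3\<bar> = 1" using assms(1) by simp
  then obtain s :: real where s: "s = 1 \<or> s = -1" "s * w $ 1 = a \<or> s * w $ 2 = a \<or> s * w $ 3 = 1"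
    by (metis abs_minus_cancel abs_if minus_mult_minus mult_minus1)
  have "\<bar>w $ 1\<bar> \<le> box_norm a w" "\<bar>w $ 2\<bar> \<le> box_norm a w" "a * \<bar>w $ 3\<bar> \<le> box_norm a w"
    by (simp_all add: box_norm_def)
  then have le: "\<bar>w $ 1\<bar> \<le> a" "\<bar>w $ 2\<bar> \<le> a" "\<bar>w $ 3\<bar> \<le> 1"
    using assms(1) by (simp_all add: w)
  \<comment> \<open>These solve \<open>box_vector a (x, y, z) = s *\<^sub>R w\<close>.\<close>
  define x y z where "x = (s * w $ 1 + a) / 2" and "y = (s * w $ 2 + a) / 2" and "z = (s * w $ 3 + 1) / 2"
  have "box_vector a (x, y, z) = s *\<^sub>R w"
    by (simp add: vec_eq_iff forall_3 x_def y_def z_def field_simps)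
  then have "A = line a (x, y, z)" using Aw [of s] s(1) by (auto simp: line_def)
  then show thesis
    using that [of x y z] le s by (auto simp: x_def y_def z_def abs_le_iff)
qed

lemma continuous_on_box_vector [continuous_intros]:
  "continuous_on T f \<Longrightarrow> continuous_on T (\<lambda>t. box_vector a (f t))"
  unfolding box_vector_def split_def by (intro continuous_intros)

text \<open>Constant on each open cell of the integer grid: even at integers, odd between them.\<close>

definition cell_label :: "real \<Rightarrow> int" where
  "cell_label x = \<lfloor>x\<rfloor> + \<lceil>x\<rceil>"

lemma cell_label_simps [simp]:
  "cell_label (real i) = 2 * int i"
  "cell_label 1 = 2"
  "cell_label (real a - x) = 2 * int a - cell_label x"
  "cell_label (1 - x) = 2 - cell_label x"
proof -
  show "cell_label (real a - x) = 2 * int a - cell_label x" for a x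
  proof -
    have "\<lfloor>real a - x\<rfloor> = int a - \<lceil>x\<rceil>" by (rule floor_unique) (simp; linarith)+
    moreover have "\<lceil>real a - x\<rceil> = int a - \<lfloor>x\<rfloor>" by (rule ceiling_unique) (simp; linarith)+
    ultimately show ?thesis by (simp add: cell_label_def)
  qed
  from this [of 1] show "cell_label (1 - x) = 2 - cell_label x" by simp
qed (simp_all add: cell_label_def)

lemma cell_label_between [simp]:
  assumes "0 < t" "t < 1"
  shows "cell_label (real i + t) = 2 * int i + 1" "cell_label t = 1"
proof -
  have "\<lfloor>real i + t\<rfloor> = int i" "\<lceil>real i + t\<rceil> = int i + 1" for i
    using assms by (auto intro: floor_unique ceiling_unique)
  from this [of i] this [of 0]
  show "cell_label (real i + t) = 2 * int i + 1" "cell_label t = 1" by (simp_all add: cell_label_def)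
qed

definition label :: "real \<times> real \<times> real \<Rightarrow> int \<times> int \<times> int" where
  "label = (\<lambda>(x, y, z). (cell_label x, cell_label y, cell_label z))"

text \<open>Points of the surface on the same line are equal or antipodal, and
  \<open>antipode\<close> reflects each label entry. Disjointness of vertices, open arcs and open
  squares thereby becomes integer arithmetic.\<close>

lemma label_line_eq:
  assumes "0 < a" "u \<in> box_surface a" "v \<in> box_surface a" "line a u = line a v" "label u = (k, l, m)"
  shows "label v \<in> {(k, l, m), (2 * a - k, 2 * a - l, 2 - m)}"
  using assms by (cases u) (auto simp: line_eq_iff label_def antipode_def)

lemma unit_interval_cases:
  assumes "0 \<le> x" "x \<le> real a"
  obtains (integer) i where "i \<le> a" "x = real i"
  | (between) i t where "i < a" "0 < t" "t < 1" "x = real i + t"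
proof (cases "x = real (nat \<lfloor>x\<rfloor>)")
  case True
  then show thesis using assms that(1) [of "nat \<lfloor>x\<rfloor>"] by simp
next
  case False
  moreover have "real (nat \<lfloor>x\<rfloor>) \<le> x" "x < real (nat \<lfloor>x\<rfloor>) + 1" using assms by linarith+
  ultimately show thesis using assms that(2) [of "nat \<lfloor>x\<rfloor>" "x - real (nat \<lfloor>x\<rfloor>)"] by linarith
qed

lemma image_reversed_unit_interval:
  assumes "\<And>t::real. f t = g (1 - t)"
  shows "f ` {0..1} = g ` {0..1}"
proof -
  have "(\<lambda>t. 1 - t) ` {0..1} = {0..1::real}" by simp
  then show ?thesis using assms by (metis image_image image_cong)
qed

section \<open>The embedded grid\<close>

datatype arc_index = Horizontal nat nat | Vertical nat nat | Antipodal nat nat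

fun arc_coords :: "arc_index \<Rightarrow> real \<Rightarrow> real \<times> real \<times> real" where
  "arc_coords (Horizontal i j) t = (i + t, j, 1)"
| "arc_coords (Vertical i j) t = (i, j + t, 1)"
| "arc_coords (Antipodal i j) t = (i, j, t)"

text \<open>Vertices are numbered by \<open>prod_encode\<close> because the final statement asks for
  natural numbers as vertices. The segment \<open>Antipodal i j\<close> starts at
  \<open>(i, j, 0)\<close>, which spans the same line as the grid point
  \<open>(a - i, a - j, 1)\<close>.\<close>

fun arc_ends :: "nat \<Rightarrow> arc_index \<Rightarrow> nat set" where
  "arc_ends a (Horizontal i j) = {prod_encode (i, j), prod_encode (Suc i, j)}"
| "arc_ends a (Vertical i j) = {prod_encode (i, j), prod_encode (i, Suc j)}"
| "arc_ends a (Antipodal i j) = {prod_encode (i, j), prod_encode (a - i, a - j)}"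

text \<open>The segments \<open>Antipodal 0 a\<close> and \<open>Antipodal a 0\<close> span the same lines, and only the latter is
  kept; \<open>Antipodal i 0\<close> and \<open>Antipodal 0 j\<close> are covered by their antipodes in the same way.\<close>

definition arcs :: "nat \<Rightarrow> arc_index set" where
  "arcs a = {Horizontal i j |i j. i < a \<and> j \<le> a} \<union> {Vertical i j |i j. i \<le> a \<and> j < a} \<union>
     {Antipodal i j |i j. i = a \<and> j \<le> a \<or> 0 < i \<and> i \<le> a \<and> j = a}"

definition grid_vertices :: "nat \<Rightarrow> nat set" where
  "grid_vertices a = prod_encode ` ({..a} \<times> {..a})"

definition grid_edges :: "nat \<Rightarrow> nat set set" where
  "grid_edges a = arc_ends a ` arcs a"

definition grid_point :: "nat \<Rightarrow> nat \<Rightarrow> (real ^ 3) set" where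
  "grid_point a v = (case prod_decode v of (i, j) \<Rightarrow> line a (real i, real j, 1))"

text \<open>Embeddings index curves by edges as sets of vertices, so the arc is recovered from its
  set of ends; \<open>inj_on_arc_ends\<close> justifies the inverse.\<close>

definition grid_arc :: "nat \<Rightarrow> nat set \<Rightarrow> real \<Rightarrow> (real ^ 3) set" where
  "grid_arc a e t = line a (arc_coords (the_inv_into (arcs a) (arc_ends a) e) t)"

text \<open>Unit squares on the faces \<open>z = 1\<close>, \<open>x = a\<close> and
  \<open>y = a\<close>, one face from each antipodal pair. The \<open>a * a + 2 * a\<close> squares
  fit Euler characteristic 1.\<close>

datatype cell_index = Top nat nat | Front nat | Side nat

fun cell_coords :: "nat \<Rightarrow> cell_index \<Rightarrow> real \<times> real \<Rightarrow> real \<times> real \<times> real" where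
  "cell_coords a (Top i j) (s, t) = (i + s, j + t, 1)"
| "cell_coords a (Front j) (s, t) = (a, j + s, t)"
| "cell_coords a (Side i) (s, t) = (i + s, a, t)"

definition cells :: "nat \<Rightarrow> cell_index set" where
  "cells a = {Top i j |i j. i < a \<and> j < a} \<union> {Front j |j. j < a} \<union> {Side i |i. i < a}"

lemma finite_cells: "finite (cells a)"
proof (rule finite_subset)
  show "cells a \<subseteq> (\<lambda>(i, j). Top i j) ` ({..a} \<times> {..a}) \<union> Front ` {..a} \<union> Side ` {..a}"
    by (auto simp: cells_def)
qed simp

text \<open>A grid edge changes one coordinate by 1, whereas an antipodal edge changes some
  coordinate by \<open>a\<close>, which is at least 2. Two antipodal segments with the same ends are
  equal or antipodes of each other, and \<open>arcs\<close> keeps one of each such pair.\<close>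

lemma inj_on_arc_ends:
  assumes "2 \<le> a"
  shows "inj_on (arc_ends a) (arcs a)"
proof (rule inj_onI)
  fix d d' assume "d \<in> arcs a" "d' \<in> arcs a" "arc_ends a d = arc_ends a d'"
  then show "d = d'"
    using assms by (cases d; cases d'; simp add: arcs_def doubleton_eq_iff; linarith)
qed

lemma grid_arc_ends: "2 \<le> a \<Longrightarrow> d \<in> arcs a \<Longrightarrow> grid_arc a (arc_ends a d) = (\<lambda>t. line a (arc_coords d t))"
  by (simp add: grid_arc_def fun_eq_iff the_inv_into_f_f inj_on_arc_ends)

lemma arc_coords_in_box_surface: "d \<in> arcs a \<Longrightarrow> 0 \<le> t \<Longrightarrow> t \<le> 1 \<Longrightarrow> arc_coords d t \<in> box_surface a"
  by (cases d) (auto simp: arcs_def box_surface_def)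

lemma cell_coords_in_box_surface:
  "q \<in> cells a \<Longrightarrow> w \<in> {0..1} \<times> {0..1} \<Longrightarrow> cell_coords a q w \<in> box_surface a"
  by (cases q; cases w) (auto simp: cells_def box_surface_def)

lemma continuous_on_arc_coords: "continuous_on T (arc_coords d)"
  by (cases d) (simp_all, (intro continuous_intros)+)

lemma continuous_on_cell_coords: "continuous_on T (cell_coords a q)"
proof -
  have "cell_coords a q = (\<lambda>w. cell_coords a q (fst w, snd w))" by simp
  moreover have "continuous_on T (\<lambda>w. cell_coords a q (fst w, snd w))"
    by (cases q) (simp_all del: prod.collapse, (intro continuous_intros)+)
  ultimately show ?thesis by metis
qed

text \<open>Each arc lies in one of the faces \<open>x = a\<close>, \<open>y = a\<close>,
  \<open>z = 1\<close>, and its antipode lies in the opposite face, so two points of an arc are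
  never antipodal.\<close>

lemma inj_on_line_arc:
  assumes "0 < a" "d \<in> arcs a"
  shows "inj_on (\<lambda>t. line a (arc_coords d t)) {0..1}"
proof (rule inj_onI)
  fix s t :: real assume "s \<in> {0..1}" "t \<in> {0..1}" "line a (arc_coords d s) = line a (arc_coords d t)"
  then have "arc_coords d t = arc_coords d s \<or> arc_coords d t = antipode a (arc_coords d s)"
    using assms by (simp add: line_eq_iff arc_coords_in_box_surface)
  then show "s = t" using assms by (cases d) (auto simp: antipode_def arcs_def)
qed

lemma inj_on_line_cell:
  assumes "0 < a" "q \<in> cells a"
  shows "inj_on (\<lambda>w. line a (cell_coords a q w)) ({0..1} \<times> {0..1})"
proof (rule inj_onI)
  fix v w :: "real \<times> real"
  assume "v \<in> {0..1} \<times> {0..1}" "w \<in> {0..1} \<times> {0..1}" "line a (cell_coords a q v) = line a (cell_coords a q w)"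
  then have "cell_coords a q w = cell_coords a q v \<or> cell_coords a q w = antipode a (cell_coords a q v)"
    using assms cell_coords_in_box_surface line_eq_iff by blast
  then show "v = w" using assms by (cases q; cases v; cases w) (auto simp: antipode_def cells_def)
qed

lemma embedding_map_line_arc:
  assumes "0 < a" "d \<in> arcs a" "T \<subseteq> {0..1}"
  shows "embedding_map (top_of_set T) projective_plane (\<lambda>t. line a (arc_coords d t))"
  unfolding line_def
proof (rule embedding_map_compact_projective_plane)
  show "continuous_on {0..1} (\<lambda>t. box_vector a (arc_coords d t))"
    by (intro continuous_intros continuous_on_arc_coords)
  show "inj_on (\<lambda>t. span {box_vector a (arc_coords d t)}) {0..1}"
    using inj_on_line_arc [OF assms(1,2)] by (simp add: line_def)
  show "box_vector a (arc_coords d t) \<noteq> 0" if "t \<in> {0..1}" for t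
    using that assms by (intro box_vector_nonzero arc_coords_in_box_surface) auto
qed (use assms in simp_all)

lemma embedding_map_line_cell:
  assumes "0 < a" "q \<in> cells a" "T \<subseteq> {0..1} \<times> {0..1}"
  shows "embedding_map (top_of_set T) projective_plane (\<lambda>w. line a (cell_coords a q w))"
  unfolding line_def
proof (rule embedding_map_compact_projective_plane)
  show "compact ({0..1} \<times> {0..1} :: (real \<times> real) set)" by (intro compact_Times compact_Icc)
  show "continuous_on ({0..1} \<times> {0..1}) (\<lambda>w. box_vector a (cell_coords a q w))"
    by (intro continuous_intros continuous_on_cell_coords)
  show "inj_on (\<lambda>w. span {box_vector a (cell_coords a q w)}) ({0..1} \<times> {0..1})"
    using inj_on_line_cell [OF assms(1,2)] by (simp add: line_def)
  show "box_vector a (cell_coords a q w) \<noteq> 0" if "w \<in> {0..1} \<times> {0..1}" for w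
    using that assms by (intro box_vector_nonzero cell_coords_in_box_surface)
qed fact

section \<open>Incidences between vertices, arcs and squares\<close>

fun arc_label :: "arc_index \<Rightarrow> int \<times> int \<times> int" where
  "arc_label (Horizontal i j) = (2 * int i + 1, 2 * int j, 2)"
| "arc_label (Vertical i j) = (2 * int i, 2 * int j + 1, 2)"
| "arc_label (Antipodal i j) = (2 * int i, 2 * int j, 1)"

fun square_label :: "nat \<Rightarrow> cell_index \<Rightarrow> int \<times> int \<times> int" where
  "square_label a (Top i j) = (2 * int i + 1, 2 * int j + 1, 2)"
| "square_label a (Front j) = (2 * int a, 2 * int j + 1, 1)"
| "square_label a (Side i) = (2 * int i + 1, 2 * int a, 1)"

lemma label_arc_coords: "0 < t \<Longrightarrow> t < 1 \<Longrightarrow> label (arc_coords d t) = arc_label d"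
  by (cases d) (simp_all add: label_def)

lemma label_cell_coords:
  "w \<in> {0<..<1} \<times> {0<..<1} \<Longrightarrow> label (cell_coords a q w) = square_label a q"
  by (cases q; cases w) (simp_all add: label_def)

text \<open>The label of an open arc identifies it, and the reflected label is not the label of any
  arc in \<open>arcs\<close>.\<close>

lemma line_arc_eq_imp:
  assumes "0 < a" "d \<in> arcs a" "d' \<in> arcs a" "0 < s" "s < 1" "0 < t" "t < 1"
    and "line a (arc_coords d s) = line a (arc_coords d' t)"
  shows "d = d'"
proof -
  obtain k l m where klm: "arc_label d = (k, l, m)" by (metis prod_cases3)
  have "arc_label d' \<in> {(k, l, m), (2 * int a - k, 2 * int a - l, 2 - m)}"
    using label_line_eq [of a "arc_coords d s" "arc_coords d' t" k l m] assms klm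
    by (simp add: arc_coords_in_box_surface label_arc_coords)
  then show ?thesis using assms(1-3) klm by (cases d; cases d') (auto simp: arcs_def; presburger)+
qed

text \<open>An open arc has exactly one odd label entry, a grid point has none, and reflection
  preserves parity.\<close>

lemma line_arc_not_vertex:
  assumes "0 < a" "d \<in> arcs a" "0 < t" "t < 1" "i \<le> a" "j \<le> a"
  shows "line a (arc_coords d t) \<noteq> line a (real i, real j, 1)"
proof
  assume eq: "line a (arc_coords d t) = line a (real i, real j, 1)"
  obtain k l m where klm: "arc_label d = (k, l, m)" by (metis prod_cases3)
  have "(real i, real j, 1) \<in> box_surface a" using assms(5,6) by (simp add: box_surface_def)
  then have "label (real i, real j, 1) \<in> {(k, l, m), (2 * int a - k, 2 * int a - l, 2 - m)}"
    using label_line_eq [of a "arc_coords d t" "(real i, real j, 1)" k l m] assms eq klm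
    by (simp add: arc_coords_in_box_surface label_arc_coords)
  then show False using klm by (cases d) (auto simp: label_def; presburger)+
qed

lemma line_cell_eq_imp:
  assumes "0 < a" "q \<in> cells a" "q' \<in> cells a" "v \<in> {0<..<1} \<times> {0<..<1}" "w \<in> {0<..<1} \<times> {0<..<1}"
    and "line a (cell_coords a q v) = line a (cell_coords a q' w)"
  shows "q = q'"
proof -
  obtain k l m where klm: "square_label a q = (k, l, m)" by (metis prod_cases3)
  have "v \<in> {0..1} \<times> {0..1}" "w \<in> {0..1} \<times> {0..1}" using assms(4,5) by auto
  then have "square_label a q' \<in> {(k, l, m), (2 * int a - k, 2 * int a - l, 2 - m)}"
    using label_line_eq [of a "cell_coords a q v" "cell_coords a q' w" k l m] assms klm
    by (simp add: cell_coords_in_box_surface label_cell_coords del: mem_Sigma_iff)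
  then show ?thesis using assms(1-3) klm by (cases q; cases q') (auto simp: cells_def; presburger)+
qed

text \<open>An open square has exactly two odd label entries, while a point of a closed arc has at
  most one; reflection preserves parity.\<close>

lemma line_cell_not_arc:
  assumes "0 < a" "q \<in> cells a" "d \<in> arcs a" "w \<in> {0<..<1} \<times> {0<..<1}" "t \<in> {0..1}"
  shows "line a (cell_coords a q w) \<noteq> line a (arc_coords d t)"
proof
  assume eq: "line a (cell_coords a q w) = line a (arc_coords d t)"
  obtain k l m where klm: "square_label a q = (k, l, m)" by (metis prod_cases3)
  have "w \<in> {0..1} \<times> {0..1}" using assms(4) by auto
  then have lab: "label (arc_coords d t) \<in> {(k, l, m), (2 * int a - k, 2 * int a - l, 2 - m)}"
    using label_line_eq [of a "cell_coords a q w" "arc_coords d t" k l m] assms eq klm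
    by (simp add: cell_coords_in_box_surface arc_coords_in_box_surface label_cell_coords del: mem_Sigma_iff)
  show False
    using lab klm by (cases q; cases d) (auto simp: label_def; presburger)+
qed

text \<open>Most sides are parametrised directly by an arc. The sides of \<open>Front\<close> and
  \<open>Side\<close> squares at \<open>z = 0\<close> have no arc of their own: their antipodes are
  grid edges on the opposite rim of the top, traversed backwards.\<close>

lemma line_cell_sides:
  assumes "q \<in> cells a" "s \<in> square_sides"
  shows "\<exists>d\<in>arcs a. (\<lambda>w. line a (cell_coords a q w)) ` s = (\<lambda>t. line a (arc_coords d t)) ` {0..1}"
proof -
  have along: ?thesis
    if "d \<in> arcs a" "s = g ` {0..1}" "\<And>t. cell_coords a q (g t) = arc_coords d t" for d and g :: "real \<Rightarrow> real \<times> real"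
    using that by (intro bexI [of _ d]) (simp_all add: image_image)
  have against: ?thesis
    if "d \<in> arcs a" "s = g ` {0..1}" "\<And>t. cell_coords a q (g t) = antipode a (arc_coords d (1 - t))"
    for d and g :: "real \<Rightarrow> real \<times> real"
    using that image_reversed_unit_interval [of "\<lambda>t. line a (cell_coords a q (g t))" "\<lambda>t. line a (arc_coords d t)"]
    by (intro bexI [of _ d]) (simp_all add: image_image line_antipode)
  consider (bottom) "s = (\<lambda>t. (t, 0)) ` {0..1}" | (right) "s = (\<lambda>t. (1, t)) ` {0..1}"
    | (top) "s = (\<lambda>t. (t, 1)) ` {0..1}" | (left) "s = (\<lambda>t. (0, t)) ` {0..1}"
    using assms(2) unfolding square_sides_def by (auto simp: image_def set_eq_iff)
  then show ?thesis
  proof cases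
    case bottom
    show ?thesis
    proof (cases q)
      case (Top i j)
      then show ?thesis using assms(1) by (intro along [OF _ bottom, of "Horizontal i j"]) (auto simp: cells_def arcs_def)
    next
      case (Front j)
      then show ?thesis using assms(1)
        by (intro against [OF _ bottom, of "Vertical 0 (a - Suc j)"]) (auto simp: cells_def arcs_def antipode_def)
    next
      case (Side i)
      then show ?thesis using assms(1)
        by (intro against [OF _ bottom, of "Horizontal (a - Suc i) 0"]) (auto simp: cells_def arcs_def antipode_def)
    qed
  next
    case right
    show ?thesis
    proof (cases q)
      case (Top i j)
      then show ?thesis using assms(1) by (intro along [OF _ right, of "Vertical (Suc i) j"]) (auto simp: cells_def arcs_def)
    next
      case (Front j)
      then show ?thesis using assms(1) by (intro along [OF _ right, of "Antipodal a (Suc j)"]) (auto simp: cells_def arcs_def)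
    next
      case (Side i)
      then show ?thesis using assms(1) by (intro along [OF _ right, of "Antipodal (Suc i) a"]) (auto simp: cells_def arcs_def)
    qed
  next
    case top
    show ?thesis
    proof (cases q)
      case (Top i j)
      then show ?thesis using assms(1) by (intro along [OF _ top, of "Horizontal i (Suc j)"]) (auto simp: cells_def arcs_def)
    next
      case (Front j)
      then show ?thesis using assms(1) by (intro along [OF _ top, of "Vertical a j"]) (auto simp: cells_def arcs_def)
    next
      case (Side i)
      then show ?thesis using assms(1) by (intro along [OF _ top, of "Horizontal i a"]) (auto simp: cells_def arcs_def)
    qed
  next
    case left
    show ?thesis
    proof (cases q)
      case (Top i j)
      then show ?thesis using assms(1) by (intro along [OF _ left, of "Vertical i j"]) (auto simp: cells_def arcs_def)
    next
      case (Front j)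
      then show ?thesis using assms(1) by (intro along [OF _ left, of "Antipodal a j"]) (auto simp: cells_def arcs_def)
    next
      case (Side i)
      show ?thesis
      \<comment> \<open>Over the corner \<open>(0, a)\<close> the vertical segment is represented by
        its antipode \<open>Antipodal a 0\<close>.\<close>
      proof (cases "i = 0")
        case True
        then show ?thesis using Side
          by (intro against [OF _ left, of "Antipodal a 0"]) (auto simp: cells_def arcs_def antipode_def)
      next
        case False
        then show ?thesis using assms(1) Side
          by (intro along [OF _ left, of "Antipodal i a"]) (auto simp: cells_def arcs_def)
      qed
    qed
  qed
qed

section \<open>The embedding and its faces\<close>

lemma drawing_grid:
  assumes "2 \<le> a"
  shows "drawing (grid_vertices a) (grid_edges a) (grid_point a) (grid_arc a) =
    (\<Union>d\<in>arcs a. (\<lambda>t. line a (arc_coords d t)) ` {0..1})"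
proof -
  \<comment> \<open>Every grid point is an end of some arc: the start of a horizontal one if
    \<open>i < a\<close>, and the upper end of an antipodal segment if \<open>i = a\<close>.\<close>
  have "grid_point a ` grid_vertices a \<subseteq> (\<Union>d\<in>arcs a. (\<lambda>t. line a (arc_coords d t)) ` {0..1})"
  proof (clarsimp simp: grid_vertices_def grid_point_def)
    fix i j assume ij: "i \<le> a" "j \<le> a"
    show "\<exists>d\<in>arcs a. line a (real i, real j, 1) \<in> (\<lambda>t. line a (arc_coords d t)) ` {0..1}"
    proof (cases "i < a")
      case True
      then show ?thesis using ij
        by (intro bexI [of _ "Horizontal i j"] image_eqI [of _ _ 0]) (auto simp: arcs_def)
    next
      case False
      then show ?thesis using ij
        by (intro bexI [of _ "Antipodal i j"] image_eqI [of _ _ 1]) (auto simp: arcs_def)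
    qed
  qed
  then show ?thesis
    using assms by (auto simp: drawing_def grid_edges_def grid_arc_ends)
qed

text \<open>On each of the three representative faces, a point with an integer coordinate along the
  face lies on an arc, and any other point lies in an open square.\<close>

lemma projective_plane_covered:
  assumes "0 < a" "A \<in> topspace projective_plane"
  shows "(\<exists>d\<in>arcs a. A \<in> (\<lambda>t. line a (arc_coords d t)) ` {0..1}) \<or>
    (\<exists>q\<in>cells a. A \<in> (\<lambda>w. line a (cell_coords a q w)) ` ({0<..<1} \<times> {0<..<1}))"
proof -
  have arcI: ?thesis if "d \<in> arcs a" "0 \<le> t" "t \<le> 1" "A = line a (arc_coords d t)" for d t
    using that by (intro disjI1 bexI [of _ d] image_eqI [of _ _ t]) auto
  have cellI: ?thesis
    if "q \<in> cells a" "0 < s" "s < 1" "0 < t" "t < 1" "A = line a (cell_coords a q (s, t))" for q s t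
    using that by (intro disjI2 bexI [of _ q] image_eqI [of _ _ "(s, t)"]) auto
  obtain x y z :: real where xyz: "0 \<le> x" "x \<le> a" "0 \<le> y" "y \<le> a" "0 \<le> z" "z \<le> 1"
    and A: "x = a \<or> y = a \<or> z = 1" "A = line a (x, y, z)"
    using projective_plane_point_cases [OF assms] .
  have top: ?thesis if x: "0 \<le> x" "x \<le> a" and y: "0 \<le> y" "y \<le> a" and A: "A = line a (x, y, 1)" for x y :: real
    using x
  proof (cases rule: unit_interval_cases)
    case i: (integer i)
    show ?thesis using y
    proof (cases rule: unit_interval_cases)
      case (integer j)
      then show ?thesis
        using arcI [of "Horizontal i j" 0] arcI [of "Antipodal i j" 1] i A by (cases "i < a") (auto simp: arcs_def)
    next
      case (between j t)
      then show ?thesis using arcI [of "Vertical i j" t] i A by (simp add: arcs_def)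
    qed
  next
    case i: (between i s)
    show ?thesis using y
    proof (cases rule: unit_interval_cases)
      case (integer j)
      then show ?thesis using arcI [of "Horizontal i j" s] i A by (simp add: arcs_def)
    next
      case (between j t)
      then show ?thesis using cellI [of "Top i j" s t] i A by (simp add: cells_def)
    qed
  qed
  \<comment> \<open>Representatives on the lower rim of the faces \<open>x = a\<close> and
    \<open>y = a\<close> are moved to the top face.\<close>
  have bottom: "line a (x, y, 0) = line a (a - x, a - y, 1)"
    using line_antipode [of a "(x, y, 0)"] by (simp add: antipode_def)
  consider "z = 0" | "z = 1" | (between) "0 < z" "z < 1" using xyz by linarith
  then show ?thesis
  proof cases
    case between
    show ?thesis
    proof (cases "x = a")
      case x: True
      show ?thesis using xyz(3,4)
      proof (cases rule: unit_interval_cases)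
        case (integer j)
        then show ?thesis using arcI [of "Antipodal a j" z] x between A by (simp add: arcs_def)
      next
        case (between j t)
        then show ?thesis using cellI [of "Front j" t z] x \<open>0 < z\<close> \<open>z < 1\<close> A by (simp add: cells_def)
      qed
    next
      case False
      then have y: "y = a" using A between by simp
      show ?thesis using xyz(1,2)
      proof (cases rule: unit_interval_cases)
        case (integer i)
        then show ?thesis
          using arcI [of "Antipodal i a" z] arcI [of "Antipodal a 0" "1 - z"] y between A
            line_antipode [of a "(0, a, z)"]
          by (cases "i = 0") (auto simp: arcs_def antipode_def)
      next
        case (between i s)
        then show ?thesis using cellI [of "Side i" s z] y \<open>0 < z\<close> \<open>z < 1\<close> A by (simp add: cells_def)
      qed
    qed
  qed (use top [of x y] top [of "a - x" "a - y"] xyz A bottom in auto)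
qed

lemma graph_embedding_grid:
  assumes "2 \<le> a"
  shows "graph_embedding projective_plane (grid_vertices a) (grid_edges a) (grid_point a) (grid_arc a)"
proof -
  have a: "0 < a" using assms by simp
  \<comment> \<open>All grid points have \<open>z = 1\<close> and their antipodes have
    \<open>z = 0\<close>, so distinct grid points span distinct lines.\<close>
  have inj: "inj_on (grid_point a) (grid_vertices a)"
  proof (rule inj_onI, clarsimp simp: grid_vertices_def grid_point_def)
    fix i j i' j'
    assume "i \<le> a" "j \<le> a" "i' \<le> a" "j' \<le> a" "line a (real i, real j, 1) = line a (real i', real j', 1)"
    then show "i = i' \<and> j = j'"
      using line_eq_iff [OF a, of "(real i, real j, 1)" "(real i', real j', 1)"]
      by (auto simp: box_surface_def antipode_def)
  qed
  have points: "grid_point a ` grid_vertices a \<subseteq> topspace projective_plane"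
    using line_in_projective_plane [OF a]
    by (auto simp: grid_vertices_def grid_point_def box_surface_def simp del: topspace_projective_plane)
  have ends: "{line a (arc_coords d 0), line a (arc_coords d 1)} = grid_point a ` arc_ends a d" if "d \<in> arcs a" for d
  proof (cases d)
    case (Antipodal i j)
    then have "i \<le> a" "j \<le> a" using that by (auto simp: arcs_def)
    then have "antipode a (real i, real j, 0) = (real (a - i), real (a - j), 1)"
      by (simp add: antipode_def)
    then have "line a (real i, real j, 0) = line a (real (a - i), real (a - j), 1)"
      by (metis line_antipode)
    then show ?thesis by (simp add: Antipodal grid_point_def insert_commute)
  qed (simp_all add: grid_point_def add.commute)
  have not_vertex: "line a (arc_coords d t) \<noteq> grid_point a v"
    if "d \<in> arcs a" "t \<in> {0<..<1}" "v \<in> grid_vertices a" for d t v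
    using that by (auto simp: grid_vertices_def grid_point_def line_arc_not_vertex [OF a])
  have vertices: "(\<lambda>t. line a (arc_coords d t)) ` {0<..<1} \<inter> grid_point a ` grid_vertices a = {}" if "d \<in> arcs a" for d
    using not_vertex [OF that] by blast
  have disjoint: "(\<lambda>t. line a (arc_coords d t)) ` {0<..<1} \<inter> (\<lambda>t. line a (arc_coords d' t)) ` {0<..<1} = {}"
    if "d \<in> arcs a" "d' \<in> arcs a" "arc_ends a d \<noteq> arc_ends a d'" for d d'
  proof -
    have "line a (arc_coords d s) \<noteq> line a (arc_coords d' t)" if "s \<in> {0<..<1}" "t \<in> {0<..<1}" for s t
      using that \<open>arc_ends a d \<noteq> _\<close> line_arc_eq_imp [OF a \<open>d \<in> _\<close> \<open>d' \<in> _\<close>, of s t] by auto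
    then show ?thesis by blast
  qed
  show ?thesis
    unfolding graph_embedding_def grid_edges_def ball_simps
  proof (intro conjI ballI impI)
    fix d assume d: "d \<in> arcs a"
    show "embedding_map (top_of_set {0..1}) projective_plane (grid_arc a (arc_ends a d))"
      unfolding grid_arc_ends [OF assms d] by (rule embedding_map_line_arc [OF a d order_refl])
  qed (simp_all only: grid_arc_ends [OF assms] inj points ends vertices disjoint simp_thms)
qed

text \<open>The open squares partition the complement of the drawing into finitely many connected
  sets that are closed there. The inclusion suffices for a property demanded of every face.\<close>

lemma faces_grid:
  assumes "2 \<le> a"
  shows "faces projective_plane (grid_vertices a) (grid_edges a) (grid_point a) (grid_arc a) \<subseteq>
    (\<lambda>q. (\<lambda>w. line a (cell_coords a q w)) ` ({0<..<1} \<times> {0<..<1})) ` cells a"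
    (is "_ \<subseteq> ?Q ` cells a")
  unfolding faces_def
proof (rule connected_components_of_finite_closed_partition)
  have a: "0 < a" using assms by simp
  let ?D = "drawing (grid_vertices a) (grid_edges a) (grid_point a) (grid_arc a)"
  let ?C = "topspace projective_plane - ?D"
  let ?X = "subtopology projective_plane ?C"
  have D: "?D = (\<Union>d\<in>arcs a. (\<lambda>t. line a (arc_coords d t)) ` {0..1})" by (rule drawing_grid [OF assms])
  have QC: "?Q q \<subseteq> ?C" if q: "q \<in> cells a" for q
  proof -
    have "A \<notin> ?D" if "A \<in> ?Q q" for A
    proof
      assume "A \<in> ?D"
      then obtain d t where "d \<in> arcs a" "t \<in> {0..1}" "A = line a (arc_coords d t)" unfolding D by blast
      then show False using \<open>A \<in> ?Q q\<close> line_cell_not_arc [OF a q] by blast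
    qed
    moreover have "?Q q \<subseteq> topspace projective_plane"
      using line_in_projective_plane [OF a cell_coords_in_box_surface [OF q]]
      by (auto simp del: topspace_projective_plane)
    ultimately show ?thesis by blast
  qed
  show "finite (?Q ` cells a)" by (simp add: finite_cells)
  show "pairwise disjnt (?Q ` cells a)"
  proof (intro pairwise_imageI, unfold disjnt_iff, intro allI notI)
    fix q q' A
    assume qq': "q \<in> cells a" "q' \<in> cells a" "?Q q \<noteq> ?Q q'" and A: "A \<in> ?Q q \<and> A \<in> ?Q q'"
    obtain v where v: "v \<in> {0<..<1} \<times> {0<..<1}" "A = line a (cell_coords a q v)" using A by blast
    obtain w where w: "w \<in> {0<..<1} \<times> {0<..<1}" "A = line a (cell_coords a q' w)" using A by blast
    have "q = q'" using line_cell_eq_imp [OF a qq'(1,2) v(1) w(1)] v(2) w(2) by simp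
    then show False using qq'(3) by simp
  qed
  show "topspace ?X \<subseteq> \<Union> (?Q ` cells a)"
  proof
    fix A assume "A \<in> topspace ?X"
    then have A: "A \<in> topspace projective_plane" "A \<notin> ?D" unfolding topspace_subtopology by blast+
    then have "\<not> (\<exists>d\<in>arcs a. A \<in> (\<lambda>t. line a (arc_coords d t)) ` {0..1})" unfolding D by blast
    then have "\<exists>q\<in>cells a. A \<in> ?Q q" using projective_plane_covered [OF a A(1)] by satx
    then show "A \<in> \<Union> (?Q ` cells a)" by blast
  qed
  fix Q assume "Q \<in> ?Q ` cells a"
  then obtain q where q: "q \<in> cells a" "Q = ?Q q" by blast
  have cont: "continuous_map (top_of_set T) projective_plane (\<lambda>w. line a (cell_coords a q w))"
    if "T \<subseteq> {0..1} \<times> {0..1}" for T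
    using embedding_map_line_cell [OF a q(1) that] homeomorphic_imp_continuous_map
    unfolding embedding_map_def by (blast dest: continuous_map_into_fulltopology)
  let ?K = "(\<lambda>w. line a (cell_coords a q w)) ` ({0..1} \<times> {0..1})"
  have "compactin projective_plane ?K"
    by (rule image_compactin [OF _ cont [OF order_refl]]) (simp add: compactin_subtopology compact_Times)
  then have "closedin ?X (?C \<inter> ?K)"
    by (intro closedin_subtopology_Int_closed compactin_imp_closedin Hausdorff_projective_plane)
  \<comment> \<open>The sides of the compact square lie in the drawing and its interior avoids it,
    so intersecting with the complement leaves exactly the open square.\<close>
  moreover have "?C \<inter> ?K = Q"
  proof
    have "?K - Q \<subseteq> (\<Union>s\<in>square_sides. (\<lambda>w. line a (cell_coords a q w)) ` s)"
    proof
      fix A assume "A \<in> ?K - Q"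
      then obtain w where w: "w \<in> {0..1} \<times> {0..1}" "w \<notin> {0<..<1} \<times> {0<..<1}" "A = line a (cell_coords a q w)"
        unfolding q(2) by blast
      then have "\<exists>s\<in>square_sides. w \<in> s" unfolding square_sides_def by (cases w) force
      then show "A \<in> (\<Union>s\<in>square_sides. (\<lambda>w. line a (cell_coords a q w)) ` s)" using w(3) by blast
    qed
    also have "\<dots> \<subseteq> ?D"
      unfolding D
    proof (rule UN_least)
      fix s assume "s \<in> square_sides"
      then obtain d where "d \<in> arcs a" "(\<lambda>w. line a (cell_coords a q w)) ` s = (\<lambda>t. line a (arc_coords d t)) ` {0..1}"
        using line_cell_sides [OF q(1)] by blast
      then show "(\<lambda>w. line a (cell_coords a q w)) ` s \<subseteq> (\<Union>d\<in>arcs a. (\<lambda>t. line a (arc_coords d t)) ` {0..1})"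
        by (simp only:) (rule UN_upper)
    qed
    finally show "?C \<inter> ?K \<subseteq> Q" by blast
    have "{0<..<1} \<times> {0<..<1} \<subseteq> ({0..1} \<times> {0..1} :: (real \<times> real) set)" by auto
    then show "Q \<subseteq> ?C \<inter> ?K" using QC [OF q(1)] unfolding q(2) by blast
  qed
  ultimately show "closedin ?X Q" by simp
  have "connectedin projective_plane Q"
    unfolding q(2)
  proof (rule connectedin_continuous_map_image [OF cont])
    show "connectedin (top_of_set ({0<..<1} \<times> {0<..<1})) ({0<..<1} \<times> {0<..<1} :: (real \<times> real) set)"
      by (simp add: connectedin_subtopology connected_Times)
  qed auto
  then show "connectedin ?X Q" using QC [OF q(1)] q(2) by (simp add: connectedin_subtopology)
qed

lemma simple_graph_grid:
  assumes "2 \<le> a"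
  shows "simple_graph (grid_vertices a) (grid_edges a)"
  unfolding simple_graph_def grid_edges_def
proof (intro conjI ballI)
  show "finite (grid_vertices a)" by (simp add: grid_vertices_def)
  fix e assume "e \<in> arc_ends a ` arcs a"
  then obtain d where "d \<in> arcs a" "e = arc_ends a d" by blast
  then show "e \<subseteq> grid_vertices a" "card e = 2"
    using assms by (cases d; auto simp: arcs_def grid_vertices_def card_insert_if)+
qed

lemma projective_quadrangulation_grid:
  assumes "2 \<le> a"
  shows "projective_quadrangulation (grid_vertices a) (grid_edges a)"
proof -
  have a: "0 < a" using assms by simp
  have "bounded_by_four_edges projective_plane (grid_edges a) (grid_arc a)
      ((\<lambda>w. line a (cell_coords a q w)) ` ({0<..<1} \<times> {0<..<1}))" (is "bounded_by_four_edges _ _ _ (?\<phi> ` _)")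
    if q: "q \<in> cells a" for q
    unfolding bounded_by_four_edges_def
  proof (intro exI [of _ ?\<phi>] conjI ballI)
    note emb = embedding_map_line_cell [OF a q]
    show "continuous_map (top_of_set ({0..1} \<times> {0..1})) projective_plane ?\<phi>"
      using emb [OF order_refl] homeomorphic_imp_continuous_map
      unfolding embedding_map_def by (blast dest: continuous_map_into_fulltopology)
    show "embedding_map (top_of_set ({0<..<1} \<times> {0<..<1})) projective_plane ?\<phi>"
      by (rule emb) auto
    fix s assume s: "s \<in> square_sides"
    then show "embedding_map (top_of_set s) projective_plane ?\<phi>"
      by (intro emb) (auto simp: square_sides_def)
    obtain d where "d \<in> arcs a" "?\<phi> ` s = (\<lambda>t. line a (arc_coords d t)) ` {0..1}"
      using line_cell_sides [OF q s] by blast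
    then show "\<exists>e\<in>grid_edges a. ?\<phi> ` s = grid_arc a e ` {0..1}"
      by (intro bexI [of _ "arc_ends a d"]) (simp_all add: grid_arc_ends [OF assms] grid_edges_def)
  qed simp
  then show ?thesis
    unfolding projective_quadrangulation_def
    using simple_graph_grid [OF assms] graph_embedding_grid [OF assms] faces_grid [OF assms] by blast
qed

section \<open>Vertex count and transversals of the embedded graph\<close>

lemma card_grid_vertices: "card (grid_vertices a) = (a + 1)\<^sup>2"
proof -
  have "card (grid_vertices a) = card ({..a} \<times> {..a})"
    unfolding grid_vertices_def by (rule card_image) (rule inj_prod_encode)
  then show ?thesis by (simp add: card_cartesian_product power2_eq_square)
qed

text \<open>Membership in one side of a bipartition of the remaining graph is the colouring for the
  combinatorial bound; decoding vertices to pairs preserves cardinality.\<close>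

lemma card_odd_cycle_transversal_grid:
  assumes "odd_cycle_transversal (grid_vertices a) (grid_edges a) S"
  shows "a + 1 \<le> card S"
proof -
  obtain A B where "A \<inter> B = {}" and cross: "\<forall>e\<in>{e \<in> grid_edges a. e \<inter> S = {}}. \<exists>x\<in>A. \<exists>y\<in>B. e = {x, y}"
    using assms unfolding odd_cycle_transversal_def bipartite_def by blast
  have differ: "(u \<in> A) \<noteq> (v \<in> A)" if "d \<in> arcs a" "arc_ends a d = {u, v}" "u \<notin> S" "v \<notin> S" for d u v
  proof -
    have "{u, v} \<in> {e \<in> grid_edges a. e \<inter> S = {}}" using that by (auto simp: grid_edges_def)
    then have "\<exists>x\<in>A. \<exists>y\<in>B. {u, v} = {x, y}" using cross by blast
    then show ?thesis using \<open>A \<inter> B = {}\<close> by (auto simp: doubleton_eq_iff)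
  qed
  let ?S = "prod_decode ` S"
  have S: "S \<subseteq> grid_vertices a" using assms by (simp add: odd_cycle_transversal_def)
  have mem: "(i, j) \<in> ?S \<longleftrightarrow> prod_encode (i, j) \<in> S" for i j
    by (metis image_iff prod_decode_inverse prod_encode_inverse)
  have "a + 1 \<le> card ?S"
  proof (rule card_transversal_antipodal_grid [where c = "\<lambda>w. prod_encode w \<in> A"])
    show "?S \<subseteq> {..a} \<times> {..a}" using S by (force simp: grid_vertices_def)
    fix i j
    show "(prod_encode (i, j) \<in> A) \<noteq> (prod_encode (Suc i, j) \<in> A)"
      if "i < a" "j \<le> a" "(i, j) \<notin> ?S" "(Suc i, j) \<notin> ?S"
      using that differ [of "Horizontal i j"] by (simp add: mem arcs_def)
    show "(prod_encode (i, j) \<in> A) \<noteq> (prod_encode (i, Suc j) \<in> A)"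
      if "i \<le> a" "j < a" "(i, j) \<notin> ?S" "(i, Suc j) \<notin> ?S"
      using that differ [of "Vertical i j"] by (simp add: mem arcs_def)
    show "(prod_encode (i, a) \<in> A) \<noteq> (prod_encode (a - i, 0) \<in> A)"
      if "i \<le> a" "(i, a) \<notin> ?S" "(a - i, 0) \<notin> ?S"
    \<comment> \<open>For \<open>i = 0\<close> the edge between \<open>(0, a)\<close> and
      \<open>(a, 0)\<close> is indexed by \<open>Antipodal a 0\<close>, the representative kept in
      \<open>arcs\<close>.\<close>
    proof (cases "i = 0")
      case True
      then show ?thesis
        using that differ [of "Antipodal a 0" "prod_encode (a, 0)" "prod_encode (0, a)"] by (simp add: mem arcs_def)
    next
      case False
      then show ?thesis using that differ [of "Antipodal i a"] by (simp add: mem arcs_def)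
    qed
  qed
  then show ?thesis by (simp add: card_image inj_prod_decode)
qed

theorem theorem1p3:
  shows "infinite {n :: nat. n > 0 \<and>
    (\<exists>(V :: nat set) E. projective_quadrangulation V E \<and> \<not> bipartite V E \<and> card V = n \<and>
       \<not> (\<exists>S. odd_cycle_transversal V E S \<and> real (card S) < sqrt (real n)))}"
    (is "infinite ?N")
proof -
  have "(a + 1)\<^sup>2 \<in> ?N" if "2 \<le> a" for a :: nat
  proof -
    \<comment> \<open>In a bipartite graph the empty set would be a transversal, against the
      positive lower bound \<open>a + 1\<close>.\<close>
    have "\<not> bipartite (grid_vertices a) (grid_edges a)"
      using card_odd_cycle_transversal_grid [of a "{}"] by (auto simp: odd_cycle_transversal_def)
    moreover have "\<not> real (card S) < sqrt (real ((a + 1)\<^sup>2))"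
      if "odd_cycle_transversal (grid_vertices a) (grid_edges a) S" for S
      using card_odd_cycle_transversal_grid [OF that] by (simp add: real_sqrt_unique)
    ultimately show ?thesis
      using projective_quadrangulation_grid [OF that] card_grid_vertices [of a] by fastforce
  qed
  then have "(\<lambda>a. (a + 1)\<^sup>2) ` {2..} \<subseteq> ?N" by auto
  moreover have "inj_on (\<lambda>a::nat. (a + 1)\<^sup>2) {2..}" by (rule inj_onI) simp
  ultimately show ?thesis using infinite_Ici [of "2::nat"] by (meson finite_imageD finite_subset)
qed

end
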